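(* The Banach space $C([0,1])$ has no Besselian Schauder frame and, consequently, has no unconditional Schauder frame.
   Context: $C([0,1])$ is the Banach space of continuous scalar-valued functions on $[0,1]$ with the supremum norm. A Schauder frame for a Banach space $E$ is a sequence $((a_n,b_n^* ))_{n\ge1}$ in $E\times E^*$ such that for every $x\in E$ the series $\sum_n b_n^*(x)a_n$ converges in norm to $x$; it is an unconditional Schauder frame if all these series converge unconditionally, and a Besselian Schauder frame if there is $B>0$ with $\sum_{n=1}^\infty|b_n^*(x)||y^*(a_n)|\le B\|x\|_E\|y^*\|_{E^*}$ for all $x\in E$, $y^*\in E^*$. *)

theory Defs
  imports "HOL-Analysis.Analysis"
begin

section \<open>The Banach space of continuous functions on the unit interval\<close>

typedef unit_interval = "{0..1::real}"
  morphisms real_of_unit Abs_unit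
  by (rule exI[of _ 0]) simp

instantiation unit_interval :: metric_space
begin

definition dist_unit_interval :: "unit_interval \<Rightarrow> unit_interval \<Rightarrow> real"
  where "dist_unit_interval s t = dist (real_of_unit s) (real_of_unit t)"

definition uniformity_unit_interval :: "(unit_interval \<times> unit_interval) filter"
  where "uniformity_unit_interval = (INF e\<in>{0 <..}. principal {(s, t). dist s t < e})"

definition open_unit_interval :: "unit_interval set \<Rightarrow> bool"
  where "open_unit_interval U \<longleftrightarrow> (\<forall>s\<in>U. \<forall>\<^sub>F (s', t) in uniformity. s' = s \<longrightarrow> t \<in> U)"

instance
proof
  fix r s t :: unit_interval
  show "dist s t = 0 \<longleftrightarrow> s = t"
    by (simp add: dist_unit_interval_def real_of_unit_inject)
  show "dist s t \<le> dist s r + dist t r"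
    unfolding dist_unit_interval_def by (rule dist_triangle2)
qed (rule open_unit_interval_def uniformity_unit_interval_def)+

end

lemma continuous_on_real_of_unit: "continuous_on S real_of_unit"
  unfolding continuous_on_iff dist_unit_interval_def by blast

lemma continuous_on_Abs_unit: "continuous_on {0..1} Abs_unit"
  unfolding continuous_on_iff dist_unit_interval_def
  by (auto simp: Abs_unit_inverse)

lemma compact_UNIV_unit_interval: "compact (UNIV :: unit_interval set)"
proof -
  have "(UNIV :: unit_interval set) = Abs_unit ` {0..1}"
    by (metis type_definition.Abs_image type_definition_unit_interval)
  then show ?thesis
    using compact_continuous_image[OF continuous_on_Abs_unit] by simp
qed

instance bcontfun :: (metric_space, banach) banach ..

text \<open>Since the unit interval is compact, bounded continuous functions on it are all
  continuous functions, and the norm of \<open>'k unit_continuous\<close> is the supremum norm.\<close>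

type_synonym 'k unit_continuous = "unit_interval \<Rightarrow>\<^sub>C 'k"

lemma bcontfun_unit_interval_iff:
  fixes f :: "unit_interval \<Rightarrow> 'k::metric_space"
  shows "f \<in> bcontfun \<longleftrightarrow> continuous_on UNIV f"
  using compact_imp_bounded[OF compact_continuous_image[OF _ compact_UNIV_unit_interval]]
  by (auto simp: bcontfun_def)

lemma unit_continuous_extends:
  fixes f :: "real \<Rightarrow> 'k::metric_space"
  assumes "continuous_on {0..1} f"
  obtains g :: "'k unit_continuous" where "\<And>s. g s = f (real_of_unit s)"
proof -
  have "continuous_on UNIV (\<lambda>s. f (real_of_unit s))"
    by (rule continuous_on_compose2[OF assms continuous_on_real_of_unit])
      (use real_of_unit in auto)
  then show thesis
    using that[of "Bcontfun (\<lambda>s. f (real_of_unit s))"]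
    by (simp add: Bcontfun_inverse bcontfun_unit_interval_iff)
qed

lemma norm_unit_continuous:
  fixes f :: "'k::real_normed_vector unit_continuous"
  shows "norm f = (SUP s. norm (f s))"
  by (simp add: norm_bcontfun_def dist_bcontfun_def)

context
  includes bcontfun.lifting
begin

lift_definition unit_continuous_scale ::
    "'k \<Rightarrow> 'k::real_normed_field unit_continuous \<Rightarrow> 'k unit_continuous"
  is "\<lambda>c f s. c * f s"
  by (auto simp: bcontfun_unit_interval_iff intro: continuous_intros)

end

lemma vector_space_unit_continuous_scale:
  "vector_space (unit_continuous_scale :: 'k::real_normed_field \<Rightarrow> _)"
  by standard
    (auto intro!: bcontfun_eqI simp: unit_continuous_scale.rep_eq algebra_simps)

lemma unit_continuous_scale_of_real: "unit_continuous_scale (of_real r) f = r *\<^sub>R f"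
  by (auto intro!: bcontfun_eqI simp: unit_continuous_scale.rep_eq scaleR_conv_of_real)

lemma unit_continuous_scale_real: "unit_continuous_scale = ((*\<^sub>R) :: real \<Rightarrow> _)"
  using unit_continuous_scale_of_real[where 'a = real] by (intro ext) simp

lemma norm_unit_continuous_scale: "norm (unit_continuous_scale c f) = norm c * norm f"
proof (rule antisym)
  have upper: "norm (unit_continuous_scale a g) \<le> norm a * norm g" for a :: 'a and g
    by (rule norm_bound)
      (simp add: unit_continuous_scale.rep_eq norm_mult mult_left_mono norm_bounded)
  then show "norm (unit_continuous_scale c f) \<le> norm c * norm f" .
  show "norm c * norm f \<le> norm (unit_continuous_scale c f)"
  proof (cases "c = 0")
    case False
    have "unit_continuous_scale (inverse c) (unit_continuous_scale c f) = f"
      using False by (auto intro!: bcontfun_eqI simp: unit_continuous_scale.rep_eq)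
    then have "norm f \<le> norm (inverse c) * norm (unit_continuous_scale c f)"
      using upper[of "inverse c" "unit_continuous_scale c f"] by simp
    then show ?thesis
      using False by (simp add: norm_divide field_simps)
  qed simp
qed

section \<open>Schauder frames\<close>

text \<open>A Banach space over the scalar field \<open>'k\<close> (the reals or the complex numbers) is a
  type of class \<^class>\<open>banach\<close> together with a scalar multiplication \<open>smul\<close> by elements of
  \<open>'k\<close> that extends the real one and satisfies
  \<open>norm (smul c x) = norm c * norm x\<close>. Its dual consists of the bounded real-linear maps
  into \<open>'k\<close> that are homogeneous with respect to \<open>smul\<close>; the norm of \<open>'e \<Rightarrow>\<^sub>L 'k\<close> is the
  usual dual norm.\<close>

definition dual_space ::
    "('k::real_normed_field \<Rightarrow> 'e::banach \<Rightarrow> 'e) \<Rightarrow> ('e \<Rightarrow>\<^sub>L 'k) set"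
  where "dual_space smul = {f. \<forall>c x. blinfun_apply f (smul c x) = c * blinfun_apply f x}"

definition schauder_frame ::
    "('k::real_normed_field \<Rightarrow> 'e::banach \<Rightarrow> 'e) \<Rightarrow>
      (nat \<Rightarrow> 'e) \<Rightarrow> (nat \<Rightarrow> 'e \<Rightarrow>\<^sub>L 'k) \<Rightarrow> bool"
  where "schauder_frame smul a b \<longleftrightarrow>
    (\<forall>n. b n \<in> dual_space smul) \<and>
    (\<forall>x. (\<lambda>n. smul (blinfun_apply (b n) x) (a n)) sums x)"

definition unconditionally_summable :: "(nat \<Rightarrow> 'e::real_normed_vector) \<Rightarrow> bool"
  where "unconditionally_summable u \<longleftrightarrow> (\<forall>\<pi>. bij \<pi> \<longrightarrow> summable (\<lambda>n. u (\<pi> n)))"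

definition unconditional_schauder_frame ::
    "('k::real_normed_field \<Rightarrow> 'e::banach \<Rightarrow> 'e) \<Rightarrow>
      (nat \<Rightarrow> 'e) \<Rightarrow> (nat \<Rightarrow> 'e \<Rightarrow>\<^sub>L 'k) \<Rightarrow> bool"
  where "unconditional_schauder_frame smul a b \<longleftrightarrow>
    schauder_frame smul a b \<and>
    (\<forall>x. unconditionally_summable (\<lambda>n. smul (blinfun_apply (b n) x) (a n)))"

definition besselian_schauder_frame ::
    "('k::real_normed_field \<Rightarrow> 'e::banach \<Rightarrow> 'e) \<Rightarrow>
      (nat \<Rightarrow> 'e) \<Rightarrow> (nat \<Rightarrow> 'e \<Rightarrow>\<^sub>L 'k) \<Rightarrow> bool"
  where "besselian_schauder_frame smul a b \<longleftrightarrow>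
    schauder_frame smul a b \<and>
    (\<exists>B>0. \<forall>x. \<forall>y\<in>dual_space smul.
      summable (\<lambda>n. norm (blinfun_apply (b n) x) * norm (blinfun_apply y (a n))) \<and>
      (\<Sum>n. norm (blinfun_apply (b n) x) * norm (blinfun_apply y (a n)))
        \<le> B * norm x * norm y)"

end

theory Submission
  imports Defs
begin

text \<open>For a frame of \<open>C([0,1])\<close> one constructs functions with values in \<open>[0, 1]\<close>, starting from 0
  and alternately adding and subtracting bumps with shrinking nested supports, such that the sums
  of \<open>norm (b n x) * norm (a n s)\<close> over \<open>n\<close> grow without bound at some points \<open>s\<close>. Testing the
  Besselian inequality with point evaluations makes these sums at most \<open>B * norm x\<close>, a
  contradiction. For an unconditional frame the uniform boundedness principle, applied to the
  finite partial sum operators, gives the same kind of bound.\<close>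

section \<open>Uniform boundedness and finite sums of unconditionally convergent series\<close>

text \<open>Baire category argument: the closed sets \<open>C k\<close> cover the space, so one of
  them contains a ball. Differences of points of that ball then control \<open>T i\<close> in every
  direction, with a constant that does not depend on \<open>i\<close>.\<close>

lemma uniform_boundedness:
  fixes T :: "'i \<Rightarrow> 'a::banach \<Rightarrow> 'b::real_normed_vector"
  assumes lin: "\<And>i. i \<in> I \<Longrightarrow> bounded_linear (T i)"
    and bdd: "\<And>x. \<exists>c. \<forall>i\<in>I. norm (T i x) \<le> c"
  shows "\<exists>M. \<forall>i\<in>I. \<forall>x. norm (T i x) \<le> M * norm x"
proof -
  define C where "C k = {x. \<forall>i\<in>I. norm (T i x) \<le> real k}" for k :: nat
  have closed: "closed (C k)" for k
  proof -
    have "C k = (\<Inter>i\<in>I. {x. norm (T i x) \<le> real k})"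
      by (auto simp: C_def)
    moreover have "closed {x. norm (T i x) \<le> real k}" if "i \<in> I" for i
      by (intro closed_Collect_le continuous_on_norm continuous_on_const
          linear_continuous_on lin[OF that])
    ultimately show ?thesis by auto
  qed
  have cover: "(\<Union>k. C k) = UNIV"
  proof -
    have "\<exists>k. x \<in> C k" for x
    proof -
      obtain c where c: "\<forall>i\<in>I. norm (T i x) \<le> c" using bdd by blast
      obtain k :: nat where "c \<le> real k" using real_arch_simple by blast
      with c have "x \<in> C k" unfolding C_def by fastforce
      then show ?thesis ..
    qed
    then show ?thesis by blast
  qed
  have "\<exists>k. interior (C k) \<noteq> {}"
  proof (rule ccontr)
    assume "\<not> ?thesis"
    then have "euclidean interior_of \<Union>(range C) = {}"
      by (intro Baire_category_alt) (auto simp: closed completely_metrizable_space_euclidean)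
    then show False by (simp add: cover)
  qed
  then obtain k x0 e where e: "e > 0" "cball x0 e \<subseteq> C k"
    by (auto simp: mem_interior_cball)
  have "norm (T i x) \<le> (2 * real k / e) * norm x" if i: "i \<in> I" for i x
  proof (cases "x = 0")
    case True
    interpret bounded_linear "T i" by (rule lin[OF i])
    show ?thesis by (simp add: True zero)
  next
    case False
    interpret bounded_linear "T i" by (rule lin[OF i])
    \<comment> \<open>Rescaling \<open>x\<close> to length \<open>e\<close> keeps
      \<open>x0 + y\<close> in the closed ball, so \<open>T i y\<close> is a difference of two
      vectors of norm at most \<open>k\<close>.\<close>
    define y where "y = (e / norm x) *\<^sub>R x"
    have "norm y = e" using False e(1) by (simp add: y_def)
    then have "x0 + y \<in> C k" "x0 \<in> C k" using e by (auto simp: dist_norm subset_iff)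
    then have "norm (T i (x0 + y)) \<le> k" "norm (T i x0) \<le> k" using i by (auto simp: C_def)
    moreover have "T i y = T i (x0 + y) - T i x0" by (simp add: add)
    ultimately have "norm (T i y) \<le> 2 * real k"
      using norm_triangle_ineq4[of "T i (x0 + y)" "T i x0"] by simp
    moreover have "norm (T i y) = (e / norm x) * norm (T i x)"
      using e(1) by (simp add: y_def scaleR)
    ultimately show ?thesis using False e(1) by (simp add: field_simps)
  qed
  then show ?thesis by blast
qed

text \<open>If the finite sums are unbounded, there are finite sets \<open>G (N k)\<close> in successive blocks
  \<open>{N k..<N (Suc k)}\<close> with sums of norm greater than 1. The injection \<open>f\<close> preserves the order of
  the blocks and lists \<open>G (N k)\<close> first within its block; rearranging along \<open>f\<close> gives a
  permutation under which the series is not Cauchy.\<close>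

lemma unconditionally_summable_bounded_sums:
  fixes u :: "nat \<Rightarrow> 'a::banach"
  assumes "unconditionally_summable u"
  shows "\<exists>C. \<forall>F. finite F \<longrightarrow> norm (sum u F) \<le> C"
proof (rule ccontr)
  assume "\<not> ?thesis"
  then have unb: "\<exists>F. finite F \<and> norm (sum u F) > C" for C
    by (meson not_le)
  \<comment> \<open>Unboundedness persists beyond any \<open>m\<close>: the indices below
    \<open>m\<close> contribute at most the sum of their norms, so a sum exceeding this by 1 keeps
    norm above 1 after they are removed.\<close>
  have "\<exists>F. finite F \<and> F \<subseteq> {m..} \<and> norm (sum u F) > 1" for m
  proof -
    obtain F where F: "finite F" "norm (sum u F) > (\<Sum>n<m. norm (u n)) + 1"
      using unb by blast
    have "sum u F = sum u (F \<inter> {..<m}) + sum u (F - {..<m})"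
      using F(1) by (metis sum.Int_Diff)
    moreover have "norm (sum u (F \<inter> {..<m})) \<le> (\<Sum>n<m. norm (u n))"
      by (rule order_trans[OF norm_sum sum_mono2]) auto
    ultimately have "norm (sum u (F - {..<m})) > 1"
      using F(2) norm_triangle_ineq[of "sum u (F \<inter> {..<m})" "sum u (F - {..<m})"] by simp
    then show ?thesis using F(1) by (intro exI[of _ "F - {..<m}"]) auto
  qed
  then obtain G where G: "\<And>m. finite (G m)" "\<And>m. G m \<subseteq> {m..}" "\<And>m. norm (sum u (G m)) > 1"
    by metis
  \<comment> \<open>Including \<open>m\<close> in the maximum makes \<open>N\<close> strictly
    increasing; the successor puts all of \<open>G (N k)\<close> strictly below
    \<open>N (Suc k)\<close>.\<close>
  define N where "N = rec_nat 0 (\<lambda>_ m. Suc (Max (insert m (G m))))"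
  have N0: "N 0 = 0" and NS: "N (Suc k) = Suc (Max (insert (N k) (G (N k))))" for k
    by (simp_all add: N_def)
  have N_less: "N k < N (Suc k)" for k
    unfolding NS by (simp add: G(1) less_Suc_eq_le)
  then have N_mono: "strict_mono N"
    by (simp add: strict_mono_Suc_iff)
  have G_less: "n < N (Suc k)" if "n \<in> G (N k)" for n k
    unfolding NS using that by (simp add: G(1) less_Suc_eq_le Max_ge)
  have G_ge: "N k \<le> n" if "n \<in> G (N k)" for n k
    using that G(2) by auto
  \<comment> \<open>The number of the block that contains \<open>n\<close>.\<close>
  define j where "j n = (LEAST k. n < N (Suc k))" for n
  have j_upper: "n < N (Suc (j n))" for n
  proof -
    have "n < N (Suc n)" using strict_mono_imp_increasing[OF N_mono, of "Suc n"] by simp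
    then show ?thesis unfolding j_def by (rule LeastI)
  qed
  have j_lower: "N (j n) \<le> n" for n
  proof (cases "j n")
    case (Suc k)
    then have "\<not> n < N (Suc k)" using not_less_Least[of k "\<lambda>k. n < N (Suc k)"] by (simp add: j_def)
    then show ?thesis by (simp add: Suc)
  qed (simp add: N0)
  have j_unique: "j n = k" if "N k \<le> n" "n < N (Suc k)" for n k
  proof -
    have "N k < N (Suc (j n))" "N (j n) < N (Suc k)"
      using that j_upper[of n] j_lower[of n] by linarith+
    then show ?thesis using N_mono by (simp add: strict_mono_less)
  qed
  \<comment> \<open>Block \<open>k\<close> goes into \<open>{2 * N k..<2 * N (Suc k)}\<close>:
    members of \<open>G (N k)\<close> land below \<open>N k + N (Suc k)\<close>, the rest at or
    above it. Comparing \<open>f n\<close> with these two thresholds thus tells whether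
    \<open>n\<close> lies in an earlier block or in \<open>G (N k)\<close>.\<close>
  define f where "f n = n + (if n \<in> G (N (j n)) then N (j n) else N (Suc (j n)))" for n
  have f_ge: "2 * N (j n) \<le> f n" for n
    using j_lower[of n] N_less[of "j n"] by (simp add: f_def)
  have f_less: "f n < 2 * N (Suc (j n))" for n
    using j_upper[of n] N_less[of "j n"] by (simp add: f_def)
  have N_le: "N (Suc k) \<le> N l" if "k < l" for k l
    using that N_mono by (simp add: strict_mono_less_eq Suc_leI)
  have f_block: "f n < f m" if "j n < j m" for n m
    using f_less[of n] f_ge[of m] N_le[OF that] by linarith
  have "inj f"
  proof (rule injI)
    fix n m assume eq: "f n = f m"
    then have "j n = j m" using f_block[of n m] f_block[of m n] by (metis less_irrefl nat_neq_iff)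
    then show "n = m"
      using eq j_lower[of n] j_lower[of m] j_upper[of n] j_upper[of m]
      by (auto simp: f_def split: if_splits)
  qed
  have low: "f n < 2 * N k \<longleftrightarrow> n < N k" for n k
  proof (cases "j n < k")
    case True
    then show ?thesis using N_le[OF True] f_less[of n] j_upper[of n] by linarith
  next
    case False
    then have "N k \<le> N (j n)" using N_mono by (simp add: strict_mono_less_eq)
    then show ?thesis using f_ge[of n] j_lower[of n] by linarith
  qed
  have high: "f n < N k + N (Suc k) \<longleftrightarrow> n < N k \<or> n \<in> G (N k)" for n k
  proof -
    consider "j n < k" | "j n = k" | "k < j n" by linarith
    then show ?thesis
    proof cases
      case 1
      then show ?thesis
        using N_le[OF 1] f_less[of n] j_upper[of n] N_less[of k] by auto
    next
      case 2
      then show ?thesis using j_lower[of n] j_upper[of n] by (auto simp: f_def)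
    next
      case 3
      then have "N (Suc k) \<le> N (j n)" using N_le by blast
      then show ?thesis
        using f_ge[of n] j_lower[of n] N_less[of k] G_less[of n k] by auto
    qed
  qed
  \<comment> \<open>All naturals, listed by increasing value of \<open>f\<close>.\<close>
  define \<pi> where "\<pi> = inv f \<circ> enumerate (range f)"
  have inf: "infinite (range f)"
    using \<open>inj f\<close> by (simp add: finite_image_iff)
  have f_\<pi>: "f (\<pi> i) = enumerate (range f) i" for i
    using enumerate_in_set[OF inf] by (simp add: \<pi>_def f_inv_into_f)
  have "bij_betw \<pi> UNIV UNIV"
    unfolding \<pi>_def using bij_enumerate[OF inf] bij_betw_inv_into[of f UNIV "range f"] \<open>inj f\<close>
    by (intro bij_betw_trans) (auto simp: bij_betw_def)
  then have "bij \<pi>" .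
  \<comment> \<open>Since \<open>f (\<pi> i)\<close> increases with \<open>i\<close>, the positions
    below any threshold form an initial segment.\<close>
  have cut: "\<exists>c. {..<c} = {i. f (\<pi> i) < m}" for m
  proof -
    define c where "c = (LEAST i. m \<le> f (\<pi> i))"
    have "m \<le> f (\<pi> m)" using le_enumerate[OF inf, of m] by (simp add: f_\<pi>)
    then have c: "m \<le> f (\<pi> c)" unfolding c_def by (rule LeastI)
    have "i < c \<longleftrightarrow> f (\<pi> i) < m" for i
    proof
      assume "i < c"
      then show "f (\<pi> i) < m" using not_less_Least unfolding c_def by (metis not_le)
    next
      assume "f (\<pi> i) < m"
      with c have "f (\<pi> i) < f (\<pi> c)" by linarith
      then show "i < c" using inf by (simp add: f_\<pi>)
    qed
    then show ?thesis by auto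
  qed
  have "summable (\<lambda>i. u (\<pi> i))"
    using assms \<open>bij \<pi>\<close> by (simp add: unconditionally_summable_def)
  then have "\<exists>M. \<forall>m\<ge>M. \<forall>n. norm (\<Sum>i=m..<n. u (\<pi> i)) < 1"
    unfolding summable_Cauchy by simp
  then obtain M where M: "\<And>m n. m \<ge> M \<Longrightarrow> norm (\<Sum>i=m..<n. u (\<pi> i)) < 1"
    by blast
  obtain c where c: "{..<c} = {i. f (\<pi> i) < 2 * N M}" using cut by blast
  obtain d where d: "{..<d} = {i. f (\<pi> i) < N M + N (Suc M)}" using cut by blast
  \<comment> \<open>Counting both sides gives \<open>c = N M\<close>, hence
    \<open>c \<ge> M\<close>, as the Cauchy bound requires. The positions from \<open>c\<close> to
    \<open>d\<close> then list exactly \<open>G (N M)\<close>, whose sum has norm above 1.\<close>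
  have "\<pi> ` {..<c} = {..<N M}"
    unfolding c low using \<open>bij \<pi>\<close> by (auto simp: image_iff) (metis bij_pointE)
  then have "c = N M"
    using card_image[of \<pi> "{..<c}"] \<open>bij \<pi>\<close> by (metis bij_is_inj card_lessThan inj_on_subset subset_UNIV)
  then have "c \<ge> M" using strict_mono_imp_increasing[OF N_mono, of M] by simp
  moreover have "\<pi> ` {c..<d} = G (N M)"
  proof -
    have "{c..<d} = {i. \<pi> i \<in> G (N M)}"
    proof -
      have "{c..<d} = {..<d} - {..<c}" by auto
      also have "\<dots> = {i. \<pi> i \<in> G (N M)}"
        unfolding c d low high using G_ge[of _ M] by fastforce
      finally show ?thesis .
    qed
    then show ?thesis using \<open>bij \<pi>\<close> by (auto simp: image_iff) (metis bij_pointE)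
  qed
  moreover have "(\<Sum>i=c..<d. u (\<pi> i)) = sum u (\<pi> ` {c..<d})"
    using \<open>bij \<pi>\<close> by (subst sum.reindex) (auto intro: inj_on_subset bij_is_inj)
  ultimately show False using M[of c d] G(3)[of "N M"] by simp
qed

section \<open>Bump functions and growth of the absolute sums\<close>

lemma apply_bcontfun_sum: "apply_bcontfun (sum g A) s = (\<Sum>i\<in>A. apply_bcontfun (g i) s)"
  by (induction A rule: infinite_finite_induct) simp_all

text \<open>A trapezoid supported on \<open>{u..v}\<close> with height 1 on the middle third; this
  plateau is the interval on which the next bump can be placed.\<close>

definition bump :: "real \<Rightarrow> real \<Rightarrow> real \<Rightarrow> real"
  where "bump u v s = max 0 (min 1 (3 * min (s - u) (v - s) / (v - u)))"

lemma bump_bounds: "0 \<le> bump u v s" "bump u v s \<le> 1"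
  by (auto simp: bump_def)

lemma bump_eq_0:
  assumes "u < v" "s \<notin> {u<..<v}"
  shows "bump u v s = 0"
proof -
  have "3 * min (s - u) (v - s) / (v - u) \<le> 0"
    using assms by (intro divide_nonpos_pos) auto
  then show ?thesis by (simp add: bump_def)
qed

lemma bump_eq_1:
  assumes "u < v" "s \<in> {u + (v - u) / 3..v - (v - u) / 3}"
  shows "bump u v s = 1"
proof -
  have "1 \<le> 3 * min (s - u) (v - s) / (v - u)"
    using assms by (simp add: field_simps min_def)
  then show ?thesis by (simp add: bump_def)
qed

lemma continuous_on_bump: "u < v \<Longrightarrow> continuous_on S (bump u v)"
  unfolding bump_def by (intro continuous_intros) auto

text \<open>Averaging over many disjoint bumps: all their finite sums have norm at most 1, so for
  each \<open>n\<close> the values \<open>norm (b n (h i))\<close> have a sum over \<open>i\<close>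
  bounded independently of the number of bumps. With enough bumps, one of them has a small weighted
  sum.\<close>

lemma ex_bump_small_functionals:
  fixes b :: "nat \<Rightarrow> 'k::{real_normed_field, euclidean_space} unit_continuous \<Rightarrow>\<^sub>L 'k"
  assumes uv: "u < v" and w: "\<And>n. 0 \<le> w n" and e: "0 < e"
  obtains h p q where "u \<le> p" "p < q" "q \<le> v"
    "\<And>s. apply_bcontfun h s = of_real (bump p q (real_of_unit s))"
    "(\<Sum>n<N. norm (blinfun_apply (b n) h) * w n) \<le> e"
proof -
  \<comment> \<open>\<open>S\<close> bounds the weighted total over all bumps, whatever their number
    \<open>J\<close>; choosing \<open>J > S / e\<close> forces one bump to contribute at most
    \<open>e\<close>.\<close>
  define S where "S = (\<Sum>n<N. 2 * real DIM('k) * norm (b n) * w n)"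
  have "S \<ge> 0" unfolding S_def using w by (intro sum_nonneg mult_nonneg_nonneg) auto
  obtain J :: nat where J: "S / e < real J" using reals_Archimedean2 by blast
  then have J0: "0 < real J" using \<open>S \<ge> 0\<close> e by (meson divide_nonneg_pos le_less_trans)
  define d where "d = (v - u) / real J"
  have d: "d > 0" using uv J0 by (simp add: d_def)
  define p where "p i = u + real i * d" for i
  have p_less: "p i < p (Suc i)" for i using d by (simp add: p_def algebra_simps)
  have p_mono: "p i \<le> p k" if "i \<le> k" for i k
    using that d by (simp add: p_def)
  have "\<exists>h :: 'k unit_continuous. \<forall>s. h s = of_real (bump (p i) (p (Suc i)) (real_of_unit s))" for i
  proof -
    have "continuous_on {0..1} (\<lambda>s. of_real (bump (p i) (p (Suc i)) s) :: 'k)"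
      using continuous_on_bump[OF p_less] by (intro continuous_intros)
    then show ?thesis by (rule unit_continuous_extends) blast
  qed
  then obtain h :: "nat \<Rightarrow> 'k unit_continuous"
    where h: "\<And>i s. h i s = of_real (bump (p i) (p (Suc i)) (real_of_unit s))"
    by metis
  \<comment> \<open>At each point at most one bump is nonzero, because the open subintervals are
    disjoint.\<close>
  have norm_sum_h: "norm (sum h Q) \<le> 1" if "finite Q" for Q
  proof (rule norm_bound)
    fix s
    have eq: "sum h Q s = of_real (\<Sum>i\<in>Q. bump (p i) (p (Suc i)) (real_of_unit s))"
      by (simp add: apply_bcontfun_sum h)
    have "(\<Sum>i\<in>Q. bump (p i) (p (Suc i)) (real_of_unit s)) \<le> 1"
    proof (cases "\<exists>i\<in>Q. real_of_unit s \<in> {p i<..<p (Suc i)}")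
      case True
      then obtain i where i: "i \<in> Q" "real_of_unit s \<in> {p i<..<p (Suc i)}" by blast
      have "bump (p k) (p (Suc k)) (real_of_unit s) = 0" if "k \<noteq> i" for k
      proof (rule bump_eq_0[OF p_less])
        show "real_of_unit s \<notin> {p k<..<p (Suc k)}"
          using i(2) p_mono[of "Suc k" i] p_mono[of "Suc i" k] that by (cases "k < i") auto
      qed
      then have "(\<Sum>i\<in>Q. bump (p i) (p (Suc i)) (real_of_unit s)) = bump (p i) (p (Suc i)) (real_of_unit s)"
        using i(1) that by (subst sum.remove[of _ i]) (auto intro: sum.neutral)
      then show ?thesis by (simp add: bump_bounds)
    next
      case False
      then show ?thesis
        using bump_eq_0[OF p_less] by (subst sum.neutral) auto
    qed
    then show "norm (sum h Q s) \<le> 1"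
      unfolding eq norm_of_real by (simp add: abs_of_nonneg sum_nonneg bump_bounds)
  qed
  \<comment> \<open>A bound on all subset sums in a space of real dimension \<open>DIM('k)\<close>
    bounds the sum of norms at the cost of the factor \<open>2 * DIM('k)\<close>.\<close>
  have "(\<Sum>i<J. norm (b n (h i))) \<le> 2 * real DIM('k) * norm (b n)" for n
  proof (rule sum_norm_allsubsets_bound)
    fix Q assume "Q \<subseteq> {..<J}"
    then have "finite Q" by (rule finite_subset) simp
    have "norm (\<Sum>i\<in>Q. b n (h i)) = norm (b n (sum h Q))"
      by (simp add: blinfun.sum_right)
    also have "\<dots> \<le> norm (b n) * 1"
      by (rule order_trans[OF norm_blinfun mult_left_mono[OF norm_sum_h[OF \<open>finite Q\<close>]]]) simp
    finally show "norm (\<Sum>i\<in>Q. b n (h i)) \<le> norm (b n)" by simp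
  qed simp
  then have "(\<Sum>n<N. (\<Sum>i<J. norm (b n (h i))) * w n) \<le> S"
    unfolding S_def by (intro sum_mono mult_right_mono w)
  then have total: "(\<Sum>i<J. \<Sum>n<N. norm (b n (h i)) * w n) \<le> S"
    by (subst sum.swap) (simp add: sum_distrib_right)
  have "\<exists>i<J. (\<Sum>n<N. norm (b n (h i)) * w n) \<le> e"
  proof (rule ccontr)
    assume "\<not> ?thesis"
    then have "(\<Sum>i<J. e) \<le> (\<Sum>i<J. \<Sum>n<N. norm (b n (h i)) * w n)"
      by (intro sum_mono) (auto simp: not_le intro: less_imp_le)
    then have "real J * e \<le> S" using total by simp
    then show False using J e by (simp add: field_simps)
  qed
  then obtain i where i: "i < J" "(\<Sum>n<N. norm (b n (h i)) * w n) \<le> e" by blast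
  have "p (Suc i) \<le> p J" using i(1) by (intro p_mono) simp
  also have "p J = v" using J0 by (simp add: p_def d_def)
  finally have "p (Suc i) \<le> v" .
  moreover have "u \<le> p i" using d by (simp add: p_def)
  ultimately show thesis using that[OF _ p_less _ h i(2)] by blast
qed

text \<open>A function with values in \<open>[0, 1]\<close> that is constant, equal to 0 or 1, on \<open>{u..v}\<close> is
  flipped to the other value on a smaller interval by a bump that the functionals \<open>b n\<close>,
  \<open>n < N\<close>, hardly see. Recovering the flipped value then takes a new block of terms, whose
  contribution to the absolute sums is at least 1/2.\<close>

lemma ex_large_absolute_sums:
  fixes a :: "nat \<Rightarrow> 'k::{real_normed_field, euclidean_space} unit_continuous"
    and b :: "nat \<Rightarrow> 'k unit_continuous \<Rightarrow>\<^sub>L 'k"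
  assumes frame: "\<And>x. (\<lambda>n. unit_continuous_scale (b n x) (a n)) sums x"
  shows "\<exists>x \<rho> c u v N. 0 \<le> u \<and> u < v \<and> v \<le> 1 \<and> c \<in> {0, 1} \<and>
    (\<forall>s. apply_bcontfun x s = of_real (\<rho> s) \<and> 0 \<le> \<rho> s \<and> \<rho> s \<le> 1) \<and>
    (\<forall>s. real_of_unit s \<in> {u..v} \<longrightarrow> \<rho> s = c) \<and>
    norm ((\<Sum>n<N. unit_continuous_scale (b n x) (a n)) - x) \<le> 1 / 8 \<and>
    (\<forall>s. real_of_unit s \<in> {u..v} \<longrightarrow> real k / 2 \<le> (\<Sum>n<N. norm (b n x) * norm (a n s)))"
proof (induction k)
  case 0
  show ?case
    by (rule exI[of _ 0], rule exI[of _ "\<lambda>_. 0"], rule exI[of _ 0], rule exI[of _ 0],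
        rule exI[of _ 1], rule exI[of _ 0]) simp
next
  case (Suc k)
  then obtain x \<rho> c u v N where uv: "0 \<le> u" "u < v" "v \<le> 1" and c: "c \<in> {0, 1}"
    and x: "\<And>s. apply_bcontfun x s = of_real (\<rho> s)" and \<rho>: "\<And>s. 0 \<le> \<rho> s" "\<And>s. \<rho> s \<le> 1"
    and \<rho>c: "\<And>s. real_of_unit s \<in> {u..v} \<Longrightarrow> \<rho> s = c"
    and res: "norm ((\<Sum>n<N. unit_continuous_scale (b n x) (a n)) - x) \<le> 1 / 8"
    and large: "\<And>s. real_of_unit s \<in> {u..v} \<Longrightarrow> real k / 2 \<le> (\<Sum>n<N. norm (b n x) * norm (a n s))"
    apply (elim exE conjE)
    subgoal for x \<rho> c u v N by (rule that[of u v c x \<rho> N]) auto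
    done
  obtain h p q where pq: "u \<le> p" "p < q" "q \<le> v"
    and h: "\<And>s. apply_bcontfun h s = of_real (bump p q (real_of_unit s))"
    and small: "(\<Sum>n<N. norm (b n h) * norm (a n)) \<le> 1 / 8"
    by (rule ex_bump_small_functionals
          [where w = "\<lambda>n. norm (a n)" and e = "1/8" and N = N and b = b, OF uv(2) norm_ge_zero])
      (simp, rule that)
  \<comment> \<open>The sign \<open>1 - 2 * c\<close> is 1 for \<open>c = 0\<close> and -1 for
    \<open>c = 1\<close>, so the bump moves the value from \<open>c\<close> to \<open>1 - c\<close>
    on its plateau \<open>{u'..v'}\<close>.\<close>
  define x' where "x' = x + (1 - 2 * c) *\<^sub>R h"
  define \<rho>' where "\<rho>' s = \<rho> s + (1 - 2 * c) * bump p q (real_of_unit s)" for s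
  define u' where "u' = p + (q - p) / 3"
  define v' where "v' = q - (q - p) / 3"
  have uv': "0 \<le> u'" "u' < v'" "v' \<le> 1" "u \<le> u'" "v' \<le> v"
    using pq uv by (simp_all add: u'_def v'_def field_simps)
  have x': "apply_bcontfun x' s = of_real (\<rho>' s)" for s
    by (simp add: x'_def \<rho>'_def x h scaleR_conv_of_real)
  have \<rho>': "0 \<le> \<rho>' s \<and> \<rho>' s \<le> 1" for s
  proof (cases "real_of_unit s \<in> {u..v}")
    case True
    then show ?thesis using c \<rho>c[OF True] bump_bounds[of p q "real_of_unit s"]
      by (auto simp: \<rho>'_def)
  next
    case False
    then have "bump p q (real_of_unit s) = 0" using pq by (intro bump_eq_0) auto
    then show ?thesis using \<rho> by (simp add: \<rho>'_def)
  qed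
  have \<rho>'c: "\<rho>' s = 1 - c" if "real_of_unit s \<in> {u'..v'}" for s
  proof -
    have "bump p q (real_of_unit s) = 1"
      using that pq by (intro bump_eq_1) (auto simp: u'_def v'_def)
    moreover have "\<rho> s = c" using that uv' by (intro \<rho>c) auto
    ultimately show ?thesis by (simp add: \<rho>'_def)
  qed
  have "(\<lambda>m. \<Sum>n<m. unit_continuous_scale (b n x') (a n)) \<longlonglongrightarrow> x'"
    using frame[of x'] by (simp add: sums_def)
  then obtain N0 where "\<And>m. m \<ge> N0 \<Longrightarrow> norm ((\<Sum>n<m. unit_continuous_scale (b n x') (a n)) - x') < 1 / 8"
    unfolding LIMSEQ_iff by (metis zero_less_divide_1_iff zero_less_numeral)
  then obtain N' where N': "N \<le> N'"
    and res': "norm ((\<Sum>n<N'. unit_continuous_scale (b n x') (a n)) - x') \<le> 1 / 8"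
    by (metis less_imp_le max.cobounded1 max.cobounded2)
  have eval: "norm ((\<Sum>n<m. b n y * a n s) - y s) \<le> 1 / 8"
    if "norm ((\<Sum>n<m. unit_continuous_scale (b n y) (a n)) - y) \<le> 1 / 8" for m y s
    using order_trans[OF norm_bounded[of "(\<Sum>n<m. unit_continuous_scale (b n y) (a n)) - y" s] that]
    by (simp add: apply_bcontfun_sum unit_continuous_scale.rep_eq)
  have c1: "\<bar>1 - 2 * c\<bar> = 1" using c by auto
  have bx': "b n x' = b n x + (1 - 2 * c) *\<^sub>R b n h" for n
    by (simp add: x'_def blinfun.add_right blinfun.scaleR_right)
  have "real (Suc k) / 2 \<le> (\<Sum>n<N'. norm (b n x') * norm (a n s))"
    if s: "real_of_unit s \<in> {u'..v'}" for s
  proof -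
    have s_uv: "real_of_unit s \<in> {u..v}" using s uv' by auto
    have split: "(\<Sum>n<N'. g n) = (\<Sum>n<N. g n) + (\<Sum>n=N..<N'. g n)" for g :: "nat \<Rightarrow> 'c::comm_monoid_add"
      using N' by (simp add: sum.atLeastLessThan_concat lessThan_atLeast0)
    have small_s: "(\<Sum>n<N. norm (b n h) * norm (a n s)) \<le> 1 / 8"
      by (rule order_trans[OF sum_mono small]) (simp add: mult_left_mono norm_bounded)
    \<comment> \<open>Replacing \<open>x\<close> by \<open>x'\<close> costs the first
      \<open>N\<close> terms at most 1/8, by the choice of the bump.\<close>
    have old: "real k / 2 - 1 / 8 \<le> (\<Sum>n<N. norm (b n x') * norm (a n s))"
    proof -
      have "norm (b n x) \<le> norm (b n x') + norm (b n h)" for n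
        using norm_triangle_ineq4[of "b n x'" "(1 - 2 * c) *\<^sub>R b n h"] c1 by (simp add: bx')
      then have "(\<Sum>n<N. norm (b n x) * norm (a n s))
          \<le> (\<Sum>n<N. (norm (b n x') + norm (b n h)) * norm (a n s))"
        by (intro sum_mono mult_right_mono) auto
      also have "\<dots> = (\<Sum>n<N. norm (b n x') * norm (a n s)) + (\<Sum>n<N. norm (b n h) * norm (a n s))"
        by (simp add: distrib_right sum.distrib)
      finally show ?thesis using large[OF s_uv] small_s by linarith
    qed
    \<comment> \<open>\<open>P\<close> stays within 1/4 of the old value \<open>c\<close>, since the
      first \<open>N\<close> functionals hardly see the bump, while \<open>Q\<close> is within 1/8
      of \<open>1 - c\<close>. Hence the terms from \<open>N\<close> to \<open>N'\<close> contribute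
      at least 5/8, and after the loss of 1/8 the net gain is 1/2.\<close>
    define P where "P = (\<Sum>n<N. b n x' * a n s)"
    define Q where "Q = (\<Sum>n<N'. b n x' * a n s)"
    have "norm (P - of_real c) \<le> 1 / 4"
    proof -
      have "P - of_real c = ((\<Sum>n<N. b n x * a n s) - x s) + (1 - 2 * c) *\<^sub>R (\<Sum>n<N. b n h * a n s)"
        by (simp add: P_def bx' x \<rho>c[OF s_uv] distrib_right sum.distrib scaleR_sum_right)
      also have "norm \<dots> \<le> norm ((\<Sum>n<N. b n x * a n s) - x s) + norm (\<Sum>n<N. b n h * a n s)"
        by (rule order_trans[OF norm_triangle_ineq]) (simp add: c1)
      also have "\<dots> \<le> 1 / 8 + 1 / 8"
      proof (rule add_mono[OF eval[OF res]])
        show "norm (\<Sum>n<N. b n h * a n s) \<le> 1 / 8"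
          by (rule order_trans[OF norm_sum]) (use small_s in \<open>simp add: norm_mult\<close>)
      qed
      finally show ?thesis by simp
    qed
    moreover have "norm (Q - of_real (1 - c)) \<le> 1 / 8"
      using eval[OF res', of s] by (simp only: Q_def x' \<rho>'c[OF s])
    moreover have "norm ((Q - P) + (P - of_real c) - (Q - of_real (1 - c))) = 1"
      using c by auto
    ultimately have "1 \<le> norm (Q - P) + 1 / 4 + 1 / 8"
      using norm_triangle_ineq4[of "(Q - P) + (P - of_real c)" "Q - of_real (1 - c)"]
        norm_triangle_ineq[of "Q - P" "P - of_real c"] by linarith
    moreover have "norm (Q - P) \<le> (\<Sum>n=N..<N'. norm (b n x') * norm (a n s))"
      unfolding P_def Q_def split[of "\<lambda>n. b n x' * a n s"]
      using norm_sum[of "\<lambda>n. b n x' * a n s" "{N..<N'}"] by (simp add: norm_mult)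
    ultimately show ?thesis
      using old by (simp add: split[of "\<lambda>n. norm (b n x') * norm (a n s)"])
  qed
  then show ?case
    using uv' c x' \<rho>' \<rho>'c res'
    by (intro exI[of _ x'] exI[of _ \<rho>'] exI[of _ "1 - c"] exI[of _ u'] exI[of _ v'] exI[of _ N']) auto
qed

lemma unit_frame_absolute_sums_unbounded:
  fixes a :: "nat \<Rightarrow> 'k::{real_normed_field, euclidean_space} unit_continuous"
    and b :: "nat \<Rightarrow> 'k unit_continuous \<Rightarrow>\<^sub>L 'k"
  assumes frame: "\<And>x. (\<lambda>n. unit_continuous_scale (b n x) (a n)) sums x"
    and bound: "\<And>x s N. (\<Sum>n<N. norm (b n x) * norm (a n s)) \<le> B * norm x"
  shows False
proof -
  \<comment> \<open>As \<open>norm x \<le> 1\<close>, the assumed bound is at most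
    \<open>\<bar>B\<bar>\<close>, which \<open>k / 2\<close> exceeds.\<close>
  obtain k :: nat where k: "2 * \<bar>B\<bar> < real k" using reals_Archimedean2 by blast
  obtain x \<rho> u v N where uv: "0 \<le> u" "u < v" "v \<le> 1"
    and x: "\<And>s. apply_bcontfun x s = of_real (\<rho> s)" "\<And>s. 0 \<le> \<rho> s" "\<And>s. \<rho> s \<le> 1"
    and large: "\<And>s. real_of_unit s \<in> {u..v} \<Longrightarrow> real k / 2 \<le> (\<Sum>n<N. norm (b n x) * norm (a n s))"
    using ex_large_absolute_sums[OF frame, of k]
    apply (elim exE conjE)
    subgoal for x \<rho> c u v N by (rule that[of u v x \<rho> N]) auto
    done
  have "norm x \<le> 1"
    by (rule norm_bound) (simp add: x)
  then have "B * norm x \<le> \<bar>B\<bar>"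
    by (metis abs_ge_self abs_ge_zero mult.right_neutral mult_mono norm_ge_zero)
  moreover have "real_of_unit (Abs_unit u) \<in> {u..v}"
    using uv by (simp add: Abs_unit_inverse)
  ultimately show False
    using large[of "Abs_unit u"] bound[of x "Abs_unit u" N] k by linarith
qed

section \<open>Point evaluations and the two kinds of frames\<close>

lemma ex_unit_evaluation:
  obtains y :: "'k::{real_normed_field, banach} unit_continuous \<Rightarrow>\<^sub>L 'k"
  where "y \<in> dual_space unit_continuous_scale" "norm y \<le> 1"
    "\<And>f. blinfun_apply y f = apply_bcontfun f s"
proof -
  define y :: "'k unit_continuous \<Rightarrow>\<^sub>L 'k" where "y = Blinfun (\<lambda>f. apply_bcontfun f s)"
  have "bounded_linear (\<lambda>f :: 'k unit_continuous. apply_bcontfun f s)"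
    by (rule bounded_linear_intro[of _ 1]) (simp_all add: norm_bounded)
  then have y: "blinfun_apply y f = apply_bcontfun f s" for f
    by (simp add: y_def bounded_linear_Blinfun_apply)
  moreover have "y \<in> dual_space unit_continuous_scale"
    by (simp add: dual_space_def y unit_continuous_scale.rep_eq)
  moreover have "norm y \<le> 1"
    by (rule norm_blinfun_bound) (simp_all add: y norm_bounded)
  ultimately show thesis using that by blast
qed

lemma not_besselian_schauder_frame:
  fixes a :: "nat \<Rightarrow> 'k::{real_normed_field, euclidean_space} unit_continuous"
  shows "\<not> besselian_schauder_frame unit_continuous_scale a b"
proof
  assume bessel: "besselian_schauder_frame unit_continuous_scale a b"
  then obtain B where "B > 0" and B: "\<And>x y. y \<in> dual_space unit_continuous_scale \<Longrightarrow>
      summable (\<lambda>n. norm (b n x) * norm (blinfun_apply y (a n))) \<and>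
      (\<Sum>n. norm (b n x) * norm (blinfun_apply y (a n))) \<le> B * norm x * norm y"
    unfolding besselian_schauder_frame_def by (elim conjE exE) (rule that, assumption, simp)
  show False
  proof (rule unit_frame_absolute_sums_unbounded)
    show "(\<lambda>n. unit_continuous_scale (b n x) (a n)) sums x" for x
      using bessel by (simp add: besselian_schauder_frame_def schauder_frame_def)
    fix x s N
    obtain y :: "'k unit_continuous \<Rightarrow>\<^sub>L 'k" where y: "y \<in> dual_space unit_continuous_scale"
      "norm y \<le> 1" "\<And>f. blinfun_apply y f = apply_bcontfun f s"
      using ex_unit_evaluation by blast
    have "summable (\<lambda>n. norm (b n x) * norm (a n s))"
      and le: "(\<Sum>n. norm (b n x) * norm (a n s)) \<le> B * norm x * norm y"
      using B[OF y(1), of x] by (simp_all add: y(3))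
    then have "(\<Sum>n<N. norm (b n x) * norm (a n s)) \<le> (\<Sum>n. norm (b n x) * norm (a n s))"
      by (intro sum_le_suminf) auto
    also note le
    also have "B * norm x * norm y \<le> B * norm x"
      using \<open>B > 0\<close> y(2) by (intro mult_left_le) auto
    finally show "(\<Sum>n<N. norm (b n x) * norm (a n s)) \<le> B * norm x" .
  qed
qed

text \<open>Uniform boundedness is applied to sums over all finite index sets, not just initial
  segments: evaluated at \<open>s\<close>, these bound every subset sum of the scalars
  \<open>b n x * a n s\<close>, and hence their absolute sums.\<close>

lemma not_unconditional_schauder_frame:
  fixes a :: "nat \<Rightarrow> 'k::{real_normed_field, euclidean_space} unit_continuous"
  shows "\<not> unconditional_schauder_frame unit_continuous_scale a b"
proof
  assume uncond: "unconditional_schauder_frame unit_continuous_scale a b"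
  define T where "T F x = (\<Sum>n\<in>F. unit_continuous_scale (b n x) (a n))" for F x
  interpret vector_space "unit_continuous_scale :: 'k \<Rightarrow> _"
    by (rule vector_space_unit_continuous_scale)
  have "bounded_linear (T F)" for F
    unfolding T_def
  proof (intro bounded_linear_sum bounded_linear_intro)
    fix n x y r
    show "unit_continuous_scale (b n (x + y)) (a n)
        = unit_continuous_scale (b n x) (a n) + unit_continuous_scale (b n y) (a n)"
      by (simp add: blinfun.add_right scale_left_distrib)
    show "unit_continuous_scale (b n (r *\<^sub>R x)) (a n) = r *\<^sub>R unit_continuous_scale (b n x) (a n)"
      by (intro bcontfun_eqI) (simp add: blinfun.scaleR_right unit_continuous_scale.rep_eq)
    show "norm (unit_continuous_scale (b n x) (a n)) \<le> norm x * (norm (b n) * norm (a n))"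
      using mult_right_mono[OF norm_blinfun[of "b n" x] norm_ge_zero[of "a n"]]
      by (simp add: norm_unit_continuous_scale mult_ac)
  qed
  moreover have "\<exists>c. \<forall>F\<in>Collect finite. norm (T F x) \<le> c" for x
    using unconditionally_summable_bounded_sums uncond
    unfolding T_def unconditional_schauder_frame_def by auto
  ultimately have "\<exists>M. \<forall>F\<in>Collect finite. \<forall>x. norm (T F x) \<le> M * norm x"
    by (rule uniform_boundedness)
  then obtain M where M: "\<And>F x. finite F \<Longrightarrow> norm (T F x) \<le> M * norm x"
    by blast
  show False
  proof (rule unit_frame_absolute_sums_unbounded)
    show "(\<lambda>n. unit_continuous_scale (b n x) (a n)) sums x" for x
      using uncond by (simp add: unconditional_schauder_frame_def schauder_frame_def)
    fix x s N
    have "(\<Sum>n<N. norm (b n x * a n s)) \<le> 2 * real DIM('k) * (M * norm x)"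
    proof (rule sum_norm_allsubsets_bound)
      fix Q assume "Q \<subseteq> {..<N}"
      then have "finite Q" by (rule finite_subset) simp
      have "norm (\<Sum>n\<in>Q. b n x * a n s) = norm (T Q x s)"
        by (simp add: T_def apply_bcontfun_sum unit_continuous_scale.rep_eq)
      also have "\<dots> \<le> M * norm x"
        using norm_bounded M[OF \<open>finite Q\<close>] by (rule order_trans)
      finally show "norm (\<Sum>n\<in>Q. b n x * a n s) \<le> M * norm x" .
    qed simp
    then show "(\<Sum>n<N. norm (b n x) * norm (a n s)) \<le> (2 * real DIM('k) * M) * norm x"
      by (simp add: norm_mult mult_ac)
  qed
qed

theorem corollary14:
  shows "(\<nexists>a b. besselian_schauder_frame
            (unit_continuous_scale :: real \<Rightarrow> real unit_continuous \<Rightarrow> real unit_continuous) a b)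
       \<and> (\<nexists>a b. unconditional_schauder_frame
            (unit_continuous_scale :: real \<Rightarrow> real unit_continuous \<Rightarrow> real unit_continuous) a b)
       \<and> (\<nexists>a b. besselian_schauder_frame
            (unit_continuous_scale :: complex \<Rightarrow> complex unit_continuous \<Rightarrow> complex unit_continuous) a b)
       \<and> (\<nexists>a b. unconditional_schauder_frame
            (unit_continuous_scale :: complex \<Rightarrow> complex unit_continuous \<Rightarrow> complex unit_continuous) a b)"
  \<comment> \<open>Both \<open>real\<close> and \<open>complex\<close> are normed fields and
    Euclidean spaces, so the two lemmas cover both scalar fields.\<close>
  by (simp add: not_besselian_schauder_frame not_unconditional_schauder_frame)

end
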